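(* Let $\phi$ be a finite conjunction of xor-clauses. If $\phi$ is tree-like, then $\phi$ is UP-deducible.
   Context: **Xor-clauses.** Variables are propositional. An xor-clause is an expression $l_1\oplus\dots\oplus l_n$ of literals ($\oplus$ is exclusive or), where constants $\top$ (true), $\bot$ (false) may also occur. It is satisfied by a total truth assignment iff an odd number of its literals are true. Xor-clauses are always taken in normal form: $\neg A$ is rewritten as $A\oplus\top$ and pairs $A\oplus A$ are cancelled, so each atom occurs at most once and only positively. Equivalently, an xor-clause is an equation $x_1\oplus\dots\oplus x_k\equiv p$ with distinct variables $x_1,\dots,x_k$ and $p\in\{\bot,\top\}$ (the xor-clause $x_1\oplus\dots\oplus x_k$ is $x_1\oplus\dots\oplus x_k\equiv\top$, and $x_1\oplus\dots\oplus x_k\oplus\top$ is $x_1\oplus\dots\oplus x_k\equiv\bot$). The literal $x$ is identified with $(x\equiv\top)$ and $\neg x$ with $x\oplus\top$, i.e. $(x\equiv\bot)$. The empty xor-clause $()$ is unsatisfiable and is identified with $\bot$. $\mathrm{vars}(\phi)$ is the set of variables occurring in $\phi$, and $\mathrm{lits}(\phi)=\{x,\neg x\mid x\in\mathrm{vars}(\phi)\}$. $\models$ denotes logical consequence. **UP-derivations.** $C[A/D]$ denotes the normal form of the xor-clause obtained from $C$ by replacing the atom $A$ by $D$. The system UP has two inference rules, for a variable $x$ and an xor-clause $C$: from $x$ and $C$ infer $C[x/\top]$; from $x\oplus\top$ and $C$ infer $C[x/\bot]$. A UP-derivation from a conjunction $\psi$ of xor-clauses is a finite sequence of xor-clauses,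 each of which is in $\psi$ or is inferred from two earlier ones by one of the rules. $\psi\vdash_{\mathrm{up}}D$ means that $D$ occurs in some UP-derivation from $\psi$. **UP-deducible.** $\phi$ is UP-deducible if for all $k\ge 0$ and all $\tilde l_1,\dots,\tilde l_k,\hat l\in\mathrm{lits}(\phi)$: (i) if $\phi\wedge\tilde l_1\wedge\dots\wedge\tilde l_k$ is unsatisfiable, then $\phi\wedge\tilde l_1\wedge\dots\wedge\tilde l_k\vdash_{\mathrm{up}}\bot$; and (ii) otherwise, $\phi\wedge\tilde l_1\wedge\dots\wedge\tilde l_k\models\hat l$ implies $\phi\wedge\tilde l_1\wedge\dots\wedge\tilde l_k\vdash_{\mathrm{up}}\hat l$. **Tree-like.** The constraint graph of $\phi$ is the bipartite graph whose vertices are the variables in $\mathrm{vars}(\phi)$ and the xor-clauses of $\phi$, with an edge between a variable $x$ and an xor-clause $D$ iff $x$ occurs in $D$ (xor-clause vertices are also labelled by their parity $p$). $\phi$ is tree-like if its constraint graph is a tree or a union of disjoint trees. *)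

theory Defs
  imports "HOL-Library.FSet" "Graph_Theory.Digraph_Component"
begin

text \<open>
  A value of type \<open>'a xor_clause\<close> is an xor-clause in normal form:
  \<open>Xor X c\<close> is the exclusive or of the distinct atoms in \<open>X\<close>, together with one
  further summand \<open>\<top>\<close> if \<open>c\<close> holds. As an equation it is
  \<open>x\<^sub>1 \<oplus> \<dots> \<oplus> x\<^sub>k \<equiv> p\<close> with parity \<open>p = (\<not> c)\<close>.
\<close>

datatype 'a xor_clause = Xor (atoms: "'a fset") (top_summand: bool)

definition satisfies :: "('a \<Rightarrow> bool) \<Rightarrow> 'a xor_clause \<Rightarrow> bool" where
  "satisfies \<tau> C \<longleftrightarrow> odd (fcard (ffilter \<tau> (atoms C)) + of_bool (top_summand C))"

lemma satisfies_parity: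
  "satisfies \<tau> (Xor X c) \<longleftrightarrow> odd (fcard (ffilter \<tau> X)) = (\<not> c)"
  by (auto simp: satisfies_def)

definition pos :: "'a \<Rightarrow> 'a xor_clause" where
  "pos x = Xor {|x|} False"

definition neg :: "'a \<Rightarrow> 'a xor_clause" where
  "neg x = Xor {|x|} True"

definition xtrue :: "'a xor_clause" where
  "xtrue = Xor {||} True"

text \<open>The empty xor-clause \<open>()\<close>, identified with \<open>\<bottom>\<close>.\<close>

definition xfalse :: "'a xor_clause" where
  "xfalse = Xor {||} False"

text \<open>Normal form of \<open>C \<oplus> D\<close>: pairs of equal summands cancel.\<close>

definition xor_add :: "'a xor_clause \<Rightarrow> 'a xor_clause \<Rightarrow> 'a xor_clause" where
  "xor_add C D = Xor ((atoms C |-| atoms D) |\<union>| (atoms D |-| atoms C))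
     (top_summand C \<noteq> top_summand D)"

text \<open>\<open>xor_subst C x D\<close> is \<open>C[x/D]\<close>.\<close>

definition xor_subst :: "'a xor_clause \<Rightarrow> 'a \<Rightarrow> 'a xor_clause \<Rightarrow> 'a xor_clause" where
  "xor_subst C x D =
     (if x |\<in>| atoms C then xor_add (Xor (atoms C |-| {|x|}) (top_summand C)) D else C)"

text \<open>A conjunction of xor-clauses is represented by the set of its conjuncts.\<close>

definition xvars :: "'a xor_clause set \<Rightarrow> 'a set" where
  "xvars \<phi> = (\<Union>C\<in>\<phi>. fset (atoms C))"

definition lits :: "'a xor_clause set \<Rightarrow> 'a xor_clause set" where
  "lits \<phi> = pos ` xvars \<phi> \<union> neg ` xvars \<phi>"

definition satisfiable :: "'a xor_clause set \<Rightarrow> bool" where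
  "satisfiable \<phi> \<longleftrightarrow> (\<exists>\<tau>. \<forall>C\<in>\<phi>. satisfies \<tau> C)"

definition entails :: "'a xor_clause set \<Rightarrow> 'a xor_clause \<Rightarrow> bool" where
  "entails \<phi> D \<longleftrightarrow> (\<forall>\<tau>. (\<forall>C\<in>\<phi>. satisfies \<tau> C) \<longrightarrow> satisfies \<tau> D)"

text \<open>\<open>up_rule P C D\<close>: \<open>D\<close> is inferred from \<open>P\<close> and \<open>C\<close> by one UP rule.\<close>

inductive up_rule :: "'a xor_clause \<Rightarrow> 'a xor_clause \<Rightarrow> 'a xor_clause \<Rightarrow> bool" where
  up_pos: "up_rule (pos x) C (xor_subst C x xtrue)"
| up_neg: "up_rule (neg x) C (xor_subst C x xfalse)"

definition up_derivation :: "'a xor_clause set \<Rightarrow> 'a xor_clause list \<Rightarrow> bool" where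
  "up_derivation \<psi> Ds \<longleftrightarrow> (\<forall>i < length Ds.
     Ds ! i \<in> \<psi> \<or> (\<exists>j < i. \<exists>k < i. up_rule (Ds ! j) (Ds ! k) (Ds ! i)))"

definition up_derives :: "'a xor_clause set \<Rightarrow> 'a xor_clause \<Rightarrow> bool" where
  "up_derives \<psi> D \<longleftrightarrow> (\<exists>Ds. up_derivation \<psi> Ds \<and> D \<in> set Ds)"

text \<open>
  The list \<open>ls\<close> is \<open>l\<^sub>1, \<dots>, l\<^sub>k\<close>; the first condition does not mention the literal \<open>m\<close>.
\<close>

definition up_deducible :: "'a xor_clause set \<Rightarrow> bool" where
  "up_deducible \<phi> \<longleftrightarrow> (\<forall>ls. set ls \<subseteq> lits \<phi> \<longrightarrow>
     (\<not> satisfiable (\<phi> \<union> set ls) \<longrightarrow> up_derives (\<phi> \<union> set ls) xfalse) \<and>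
     (\<forall>m\<in>lits \<phi>. satisfiable (\<phi> \<union> set ls) \<longrightarrow>
        entails (\<phi> \<union> set ls) m \<longrightarrow> up_derives (\<phi> \<union> set ls) m))"

text \<open>
  Undirected graphs are symmetric digraphs, each edge being a pair of opposite arcs.
  The predicate \<open>tree\<close> of \<^theory>\<open>Graph_Theory.Digraph_Component\<close> does not fit this
  encoding: its notion of cycle admits length 2, so it excludes every edge. Cycles of an
  undirected simple graph have length at least 3.
\<close>

definition undirected_tree :: "'v pair_pre_digraph \<Rightarrow> bool" where
  "undirected_tree T \<longleftrightarrow> pair_graph T \<and> Digraph_Component.connected (with_proj T) \<and>
     (\<nexists>p. pre_digraph.cycle (with_proj T) p \<and> 3 \<le> length p)"

definition disjoint_union_of_trees :: "'v pair_pre_digraph \<Rightarrow> bool" where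
  "disjoint_union_of_trees G \<longleftrightarrow> (\<exists>\<T>. (\<forall>T\<in>\<T>. undirected_tree T) \<and>
     pairwise (\<lambda>S T. pverts S \<inter> pverts T = {}) \<T> \<and>
     pverts G = (\<Union>T\<in>\<T>. pverts T) \<and> parcs G = (\<Union>T\<in>\<T>. parcs T))"

definition constraint_graph ::
  "'a xor_clause set \<Rightarrow> ('a + 'a xor_clause) pair_pre_digraph" where
  "constraint_graph \<phi> =
     \<lparr> pverts = Inl ` xvars \<phi> \<union> Inr ` \<phi>,
       parcs = {(Inl x, Inr D) | x D. D \<in> \<phi> \<and> x |\<in>| atoms D} \<union>
               {(Inr D, Inl x) | x D. D \<in> \<phi> \<and> x |\<in>| atoms D} \<rparr>"

definition tree_like :: "'a xor_clause set \<Rightarrow> bool" where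
  "tree_like \<phi> \<longleftrightarrow> disjoint_union_of_trees (constraint_graph \<phi>)"

end

theory Submission
  imports Defs
begin

text \<open>
  Let \<open>U\<close> be the set of variables whose value is UP-derived, and suppose \<open>\<bottom>\<close> is not
  derived. A clause that still has an atom outside \<open>U\<close> has at least two of them, since
  otherwise a further unit clause would be derived. In a finite forest all of whose
  clause vertices have degree at least two there is, besides any prescribed vertex \<open>x\<close>, a leaf,
  and it must be a variable; the clause containing it can be satisfied last by flipping
  that variable. Hence the derived values, together with an arbitrary value for any one
  further variable \<open>x\<close>, extend to a model, so only variables in \<open>U\<close> have a forced value.
\<close>

section \<open>Cycles and leaves in symmetric relations\<close>

text \<open>Vertex lists with an explicit closing edge make this property pass to subrelations. The
  bound 3 rules out going back and forth along one edge of a symmetric relation.\<close>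

definition circuit_free :: "'v rel \<Rightarrow> bool" where
  "circuit_free E \<longleftrightarrow> (\<nexists>vs. distinct vs \<and> 3 \<le> length vs \<and>
     successively (\<lambda>u v. (u, v) \<in> E) vs \<and> (last vs, hd vs) \<in> E)"

lemma circuit_free_subset:
  assumes "circuit_free E" "F \<subseteq> E"
  shows "circuit_free F"
  unfolding circuit_free_def
proof safe
  fix vs
  assume "distinct vs" "3 \<le> length vs" "successively (\<lambda>u v. (u, v) \<in> F) vs"
    "(last vs, hd vs) \<in> F"
  moreover from this(3) have "successively (\<lambda>u v. (u, v) \<in> E) vs"
    by (rule successively_mono) (use assms(2) in auto)
  ultimately show False
    using assms unfolding circuit_free_def by blast
qed

text \<open>A longest simple path starts at a leaf: a second neighbour of its first vertex would
  either prolong the path or close a circuit. Anchoring the far end at \<open>a\<close>, if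
  \<open>a\<close> has a neighbour, keeps the leaf different from \<open>a\<close>.\<close>

lemma exists_leaf_other_than:
  assumes "finite E" "sym E" "irrefl E" "circuit_free E" "E \<noteq> {}"
  obtains b c where "b \<noteq> a" "(b, c) \<in> E" "\<And>d. (b, d) \<in> E \<Longrightarrow> d = c"
proof -
  let ?R = "\<lambda>u v. (u, v) \<in> E"
  \<comment> \<open>If \<open>a\<close> is isolated, any edge will do, since the leaf found has a
    neighbour and so cannot be \<open>a\<close>.\<close>
  obtain s w where sw: "(s, w) \<in> E" and s: "s = a \<or> (\<forall>v. (a, v) \<notin> E)"
    using assms(5) by (metis all_not_in_conv surj_pair)
  \<comment> \<open>Paths grow at the head while the end \<open>s\<close> stays fixed; length at
    least 2 makes the head differ from \<open>s\<close>.\<close>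
  define P where "P vs \<longleftrightarrow> distinct vs \<and> 2 \<le> length vs \<and> successively ?R vs \<and>
    last vs = s \<and> set vs \<subseteq> Field E" for vs
  have "P [w, s]"
    using sw assms(2,3) by (auto simp: P_def sym_def irrefl_def Field_def)
  moreover have "\<forall>vs. P vs \<longrightarrow> length vs < Suc (card (Field E))"
    using assms(1) by (auto simp: P_def finite_Field less_Suc_eq_le
        intro: card_mono simp flip: distinct_card)
  ultimately obtain vs where vs: "P vs" and longest: "\<And>us. P us \<Longrightarrow> length us \<le> length vs"
    using ex_has_greatest_nat[of P "[w, s]" length "Suc (card (Field E))"] by blast
  from vs obtain b c rest where bc: "vs = b # c # rest"
    by (cases vs; cases "tl vs") (auto simp: P_def)
  have edge: "(b, c) \<in> E"
    using vs by (auto simp: P_def bc)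
  have "b \<noteq> a"
  proof (cases "s = a")
    case True
    then show ?thesis
      using vs by (auto simp: P_def bc split: if_splits)
  next
    case False
    then show ?thesis
      using s edge by blast
  qed
  moreover have "d = c" if d: "(b, d) \<in> E" for d
  proof (rule ccontr)
    assume "d \<noteq> c"
    have db: "(d, b) \<in> E" "d \<noteq> b"
      using d assms(2,3) by (auto simp: sym_def irrefl_def)
    show False
    proof (cases "d \<in> set vs")
      case False
      then have "P (d # vs)"
        using vs db by (auto simp: P_def bc Field_def)
      then show False
        using longest by fastforce
    next
      case True
      then have "d \<in> set rest"
        using db \<open>d \<noteq> c\<close> by (simp add: bc)
      then obtain ys zs where "rest = ys @ d # zs"
        by (meson split_list)
      \<comment> \<open>The path up to \<open>d\<close> closes through the edge from
        \<open>d\<close> back to \<open>b\<close>; it has at least three vertices because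
        \<open>d\<close> is neither \<open>b\<close> nor \<open>c\<close>.\<close>
      then have "distinct (b # c # ys @ [d])" "successively ?R (b # c # ys @ [d])"
        using vs by (auto simp: P_def bc successively_Cons successively_append_iff
            hd_append split: if_splits)
      then show False
        using assms(4) db unfolding circuit_free_def
        by (elim notE) (rule exI[of _ "b # c # ys @ [d]"], auto)
    qed
  qed
  ultimately show thesis
    using that edge by blast
qed

text \<open>Cycles in \<open>with_proj T\<close> are lists of arcs. Zipping the vertex list with its
  rotation by one yields the consecutive arcs, the closing one included.\<close>

lemma circuit_imp_cycle:
  assumes "distinct (v # vs)" "successively (\<lambda>a b. (a, b) \<in> parcs T) (v # vs)"
    and "(last (v # vs), v) \<in> parcs T" "v \<in> pverts T"
  shows "pre_digraph.cycle (with_proj T) (zip (v # vs) (vs @ [v]))"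
proof -
  have "pcas u (zip (u # us) (us @ [w])) w" for u w :: 'a and us
    by (induction us arbitrary: u) auto
  moreover have "pawalk_verts u (zip (u # us) (us @ [w])) = u # us @ [w]" for u w :: 'a and us
    by (induction us arbitrary: u) auto
  moreover have "set (zip (u # us) (us @ [w])) \<subseteq> A"
    if "successively (\<lambda>a b. (a, b) \<in> A) (u # us)" "(last (u # us), w) \<in> A"
    for u w :: 'a and us A
    using that by (induction us arbitrary: u) (auto split: if_splits)
  ultimately show ?thesis
    using assms
    unfolding pre_digraph.cycle_def pre_digraph.awalk_def cas_with_proj_eq
      awalk_verts_with_proj_eq with_proj_simps
    by (intro exI[of _ v]) auto
qed

text \<open>A circuit cannot leave a tree: both ends of an arc lie in the tree owning that arc, and
  the trees share no vertices. So it would be a cycle of length at least 3 within one tree.\<close>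

lemma disjoint_union_of_trees_circuit_free:
  assumes "disjoint_union_of_trees G"
  shows "circuit_free (parcs G)"
  unfolding circuit_free_def
proof safe
  fix vs
  assume vs: "distinct vs" "3 \<le> length vs" "successively (\<lambda>u v. (u, v) \<in> parcs G) vs"
    "(last vs, hd vs) \<in> parcs G"
  obtain \<T> where forest: "\<forall>T\<in>\<T>. undirected_tree T"
    and disj: "pairwise (\<lambda>S T. pverts S \<inter> pverts T = {}) \<T>"
    and arcs: "parcs G = (\<Union>T\<in>\<T>. parcs T)"
    using assms unfolding disjoint_union_of_trees_def by (elim exE conjE)
  have wf: "u \<in> pverts T \<and> v \<in> pverts T" if "T \<in> \<T>" "(u, v) \<in> parcs T" for T u v
  proof -
    interpret pair_graph T
      using forest that(1) by (simp add: undirected_tree_def)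
    show ?thesis
      using that(2) in_arcsD1 in_arcsD2 by blast
  qed
  \<comment> \<open>The closing arc selects the tree and places the first vertex in it;
    \<open>stay\<close> then carries membership along the list.\<close>
  obtain T where T: "T \<in> \<T>" "(last vs, hd vs) \<in> parcs T"
    using vs(4) arcs by blast
  have stay: "(u, v) \<in> parcs T" if uv: "(u, v) \<in> parcs G" "u \<in> pverts T" for u v
  proof -
    obtain S where S: "S \<in> \<T>" "(u, v) \<in> parcs S"
      using uv(1) arcs by blast
    then have "S = T"
      using wf[OF S] uv(2) T(1) disj unfolding pairwise_def by blast
    then show ?thesis
      using S by blast
  qed
  have "successively (\<lambda>u v. (u, v) \<in> parcs T) us"
    if "successively (\<lambda>u v. (u, v) \<in> parcs G) us" "us \<noteq> [] \<Longrightarrow> hd us \<in> pverts T" for us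
    using that
  proof (induction us)
    case (Cons u us)
    then show ?case
      using stay wf[OF T(1)] by (cases us) auto
  qed simp
  then have "successively (\<lambda>u v. (u, v) \<in> parcs T) vs"
    using vs(3) wf[OF T] by blast
  moreover obtain v us where "vs = v # us"
    using vs(2) by (cases vs) auto
  ultimately have "pre_digraph.cycle (with_proj T) (zip (v # us) (us @ [v]))"
    and "3 \<le> length (zip (v # us) (us @ [v]))"
    using vs(1,2) T wf[OF T] circuit_imp_cycle[of v us T] by auto
  then show False
    using forest T(1) unfolding undirected_tree_def by blast
qed

section \<open>Models of forests of clauses\<close>

lemma satisfies_cong:
  assumes "\<And>x. x |\<in>| atoms C \<Longrightarrow> \<sigma> x = \<tau> x"
  shows "satisfies \<sigma> C \<longleftrightarrow> satisfies \<tau> C"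
proof -
  have "ffilter \<sigma> (atoms C) = ffilter \<tau> (atoms C)"
    using assms by auto
  then show ?thesis
    by (simp add: satisfies_def)
qed

text \<open>In normal form \<open>y\<close> occurs exactly once, so flipping it changes the number
  of true atoms by one.\<close>

lemma satisfies_fun_upd:
  assumes "y |\<in>| atoms C"
  shows "satisfies (\<tau>(y := \<not> \<tau> y)) C \<longleftrightarrow> \<not> satisfies \<tau> C"
proof -
  \<comment> \<open>Both values of \<open>y\<close> are compared with the same reference set, in
    which \<open>y\<close> is false.\<close>
  have eq: "ffilter (\<tau>(y := b)) (atoms C) =
      (if b then finsert y else id) (ffilter (\<tau>(y := False)) (atoms C))" for b
    using assms by (auto split: if_splits)
  have notin: "y |\<notin>| ffilter (\<tau>(y := False)) (atoms C)"
    by simp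
  have "odd (fcard (ffilter (\<tau>(y := b)) (atoms C))) \<longleftrightarrow>
      b \<noteq> odd (fcard (ffilter (\<tau>(y := False)) (atoms C)))" for b
    by (subst eq) (use notin in \<open>simp add: fcard_finsert_disjoint\<close>)
  from this[of "\<not> \<tau> y"] this[of "\<tau> y"] show ?thesis
    by (auto simp: satisfies_def)
qed

text \<open>The arcs of the constraint graph of \<open>F\<close> that remain after the variables in
  \<open>U\<close> are deleted.\<close>

definition residual_edges ::
  "'a xor_clause set \<Rightarrow> 'a set \<Rightarrow> ('a + 'a xor_clause) rel" where
  "residual_edges F U =
     {(Inl x, Inr D) | x D. D \<in> F \<and> x |\<in>| atoms D \<and> x \<notin> U} \<union>
     {(Inr D, Inl x) | x D. D \<in> F \<and> x |\<in>| atoms D \<and> x \<notin> U}"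

lemma sym_residual_edges: "sym (residual_edges F U)"
  by (auto simp: residual_edges_def sym_def)

lemma irrefl_residual_edges: "irrefl (residual_edges F U)"
  by (auto simp: residual_edges_def irrefl_def)

lemma finite_residual_edges:
  assumes "finite F"
  shows "finite (residual_edges F U)"
proof (rule finite_subset)
  let ?V = "Inl ` xvars F \<union> Inr ` F"
  show "residual_edges F U \<subseteq> ?V \<times> ?V"
    by (auto simp: residual_edges_def xvars_def)
  show "finite (?V \<times> ?V)"
    using assms by (auto simp: xvars_def)
qed

text \<open>Induction on the number of clauses: remove the unique clause containing a leaf variable
  \<open>y\<close>, take a model of the rest, and flip \<open>y\<close> if the removed clause fails.
  No other clause sees \<open>y\<close>, and \<open>y\<close> is neither \<open>x\<close> nor in
  \<open>U\<close>.\<close>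

lemma forest_model_extending:
  assumes "finite F" "circuit_free (residual_edges F U)"
    and "\<And>C. C \<in> F \<Longrightarrow> \<exists>y z. y \<noteq> z \<and> y |\<in>| atoms C \<and> z |\<in>| atoms C \<and> y \<notin> U \<and> z \<notin> U"
  shows "\<exists>\<tau>. (\<forall>y \<in> insert x U. \<tau> y = \<tau>0 y) \<and> (\<forall>C\<in>F. satisfies \<tau> C)"
  using assms
proof (induction "card F" arbitrary: F)
  case 0
  then show ?case by auto
next
  case (Suc n)
  let ?E = "residual_edges F U"
  obtain C0 where "C0 \<in> F"
    using Suc.hyps(2) by fastforce
  then have "?E \<noteq> {}"
    using Suc.prems(3)[of C0] by (auto simp: residual_edges_def)
  then obtain b c where leaf: "b \<noteq> Inl x" "(b, c) \<in> ?E" "\<And>d. (b, d) \<in> ?E \<Longrightarrow> d = c"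
    using exists_leaf_other_than[OF finite_residual_edges[OF Suc.prems(1)]
        sym_residual_edges irrefl_residual_edges Suc.prems(2)] by metis
  \<comment> \<open>A clause vertex has two neighbours outside \<open>U\<close>, so the leaf is a
    variable.\<close>
  have "b \<noteq> Inr D" for D
  proof
    assume b: "b = Inr D"
    then have "D \<in> F"
      using leaf(2) by (auto simp: residual_edges_def)
    then obtain y z where "y \<noteq> z" "(b, Inl y) \<in> ?E" "(b, Inl z) \<in> ?E"
      using Suc.prems(3)[of D] b by (auto simp: residual_edges_def)
    then show False
      using leaf(3) by (metis Inl_inject)
  qed
  then obtain y where b: "b = Inl y"
    by (cases b) auto
  then obtain C where C: "C \<in> F" "y |\<in>| atoms C" "y \<notin> U" "c = Inr C"
    using leaf(2) by (auto simp: residual_edges_def)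
  have only: "D = C" if "D \<in> F" "y |\<in>| atoms D" for D
    using leaf(3)[of "Inr D"] that b C by (auto simp: residual_edges_def)
  have "circuit_free (residual_edges (F - {C}) U)"
    by (rule circuit_free_subset[OF Suc.prems(2)]) (auto simp: residual_edges_def)
  then obtain \<tau> where \<tau>: "\<forall>y \<in> insert x U. \<tau> y = \<tau>0 y" "\<forall>D \<in> F - {C}. satisfies \<tau> D"
    using Suc.hyps(1)[of "F - {C}"] Suc.hyps(2) Suc.prems C(1) by fastforce
  show ?case
  proof (cases "satisfies \<tau> C")
    case True
    then show ?thesis
      using \<tau> by blast
  next
    case False
    let ?\<sigma> = "\<tau>(y := \<not> \<tau> y)"
    have "satisfies ?\<sigma> D" if "D \<in> F" for D
    proof (cases "D = C")
      case True
      then show ?thesis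
        using False C(2) satisfies_fun_upd by metis
    next
      case neq: False
      then have "y |\<notin>| atoms D"
        using only that by blast
      then have "satisfies ?\<sigma> D \<longleftrightarrow> satisfies \<tau> D"
        by (intro satisfies_cong) auto
      then show ?thesis
        using \<tau>(2) neq that by blast
    qed
    moreover have "\<forall>z \<in> insert x U. ?\<sigma> z = \<tau>0 z"
      using \<tau>(1) C(3) leaf(1) b by auto
    ultimately show ?thesis
      by blast
  qed
qed

section \<open>Unit propagation\<close>

lemma up_derives_base:
  assumes "C \<in> \<psi>"
  shows "up_derives \<psi> C"
  unfolding up_derives_def up_derivation_def
  using assms by (intro exI[of _ "[C]"]) auto

lemma up_derivation_append:
  assumes "up_derivation \<psi> Cs" "up_derivation \<psi> Ds"
  shows "up_derivation \<psi> (Cs @ Ds)"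
  unfolding up_derivation_def
proof (intro allI impI)
  fix i assume i: "i < length (Cs @ Ds)"
  show "(Cs @ Ds) ! i \<in> \<psi> \<or>
    (\<exists>j<i. \<exists>k<i. up_rule ((Cs @ Ds) ! j) ((Cs @ Ds) ! k) ((Cs @ Ds) ! i))"
  proof (cases "i < length Cs")
    case True
    then have "Cs ! i \<in> \<psi> \<or> (\<exists>j<i. \<exists>k<i. up_rule (Cs ! j) (Cs ! k) (Cs ! i))"
      using assms(1) unfolding up_derivation_def by blast
    then show ?thesis
      using True by (smt (verit) nth_append order.strict_trans)
  next
    case False
    define i' where "i' = i - length Cs"
    have i': "i = length Cs + i'" "i' < length Ds"
      using False i by (auto simp: i'_def)
    then have "Ds ! i' \<in> \<psi> \<or> (\<exists>j<i'. \<exists>k<i'. up_rule (Ds ! j) (Ds ! k) (Ds ! i'))"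
      using assms(2) unfolding up_derivation_def by blast
    then show ?thesis
      unfolding i'(1) by (metis nat_add_left_cancel_less nth_append_length_plus)
  qed
qed

text \<open>Concatenating derivations of the two premises places both before
  \<open>D\<close>.\<close>

lemma up_derives_step:
  assumes "up_derives \<psi> P" "up_derives \<psi> C" "up_rule P C D"
  shows "up_derives \<psi> D"
proof -
  obtain Ps Cs where PCs: "up_derivation \<psi> Ps" "P \<in> set Ps" "up_derivation \<psi> Cs" "C \<in> set Cs"
    using assms(1,2) unfolding up_derives_def by blast
  let ?Es = "Ps @ Cs"
  have Es: "up_derivation \<psi> ?Es" and "P \<in> set ?Es" "C \<in> set ?Es"
    using PCs up_derivation_append by auto
  then obtain j k where jk: "j < length ?Es" "?Es ! j = P" "k < length ?Es" "?Es ! k = C"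
    by (meson in_set_conv_nth)
  have "up_derivation \<psi> (?Es @ [D])"
    unfolding up_derivation_def
  proof (intro allI impI)
    fix i assume "i < length (?Es @ [D])"
    then consider "i < length ?Es" | "i = length ?Es"
      by fastforce
    then show "(?Es @ [D]) ! i \<in> \<psi> \<or>
      (\<exists>j<i. \<exists>k<i. up_rule ((?Es @ [D]) ! j) ((?Es @ [D]) ! k) ((?Es @ [D]) ! i))"
    proof cases
      case 1
      then have "?Es ! i \<in> \<psi> \<or> (\<exists>j<i. \<exists>k<i. up_rule (?Es ! j) (?Es ! k) (?Es ! i))"
        using Es unfolding up_derivation_def by blast
      then show ?thesis
        using 1 by (smt (verit) nth_append order.strict_trans)
    next
      case 2
      then show ?thesis
        using jk assms(3) by (metis nth_append nth_append_length)
    qed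
  qed
  then show ?thesis
    unfolding up_derives_def by (metis in_set_conv_decomp)
qed

section \<open>Semantics of literals and soundness of UP\<close>

lemma satisfies_no_atoms [simp]: "satisfies \<tau> (Xor {||} c) \<longleftrightarrow> c"
proof -
  have "ffilter \<tau> {||} = {||}"
    by auto
  then show ?thesis
    by (simp add: satisfies_def fcard_fempty)
qed

lemma satisfies_pos [simp]: "satisfies \<tau> (pos x) \<longleftrightarrow> \<tau> x"
proof -
  have "ffilter \<tau> {|x|} = (if \<tau> x then {|x|} else {||})"
    by auto
  then show ?thesis
    by (simp add: satisfies_def pos_def fcard_fempty fcard_finsert_disjoint)
qed

lemma satisfies_neg [simp]: "satisfies \<tau> (neg x) \<longleftrightarrow> \<not> \<tau> x"
  using satisfies_pos[of \<tau> x] by (auto simp: satisfies_def pos_def neg_def)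

lemma atoms_xor_subst:
  "atoms (xor_subst C x (Xor {||} c)) = atoms C |-| {|x|}"
  by (auto simp: xor_subst_def xor_add_def)

lemma satisfies_xor_subst:
  assumes "\<tau> x = c"
  shows "satisfies \<tau> (xor_subst C x (Xor {||} c)) \<longleftrightarrow> satisfies \<tau> C"
proof (cases "x |\<in>| atoms C")
  case True
  let ?B = "ffilter \<tau> (atoms C |-| {|x|})"
  have "x |\<notin>| ?B" "ffilter \<tau> (atoms C) = (if c then finsert x ?B else ?B)"
    using True assms by auto
  then show ?thesis
    using True by (auto simp: satisfies_def xor_subst_def xor_add_def fcard_finsert_disjoint)
qed (simp add: xor_subst_def)

lemma up_rule_sound:
  assumes "up_rule P C D" "satisfies \<tau> P" "satisfies \<tau> C"
  shows "satisfies \<tau> D"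
  using assms by cases (auto simp: xtrue_def xfalse_def satisfies_xor_subst)

lemma up_derives_sound:
  assumes "up_derives \<psi> D"
  shows "entails \<psi> D"
  unfolding entails_def
proof (intro allI impI)
  fix \<tau> assume \<tau>: "\<forall>C\<in>\<psi>. satisfies \<tau> C"
  obtain Ds where Ds: "up_derivation \<psi> Ds" "D \<in> set Ds"
    using assms unfolding up_derives_def by blast
  have "satisfies \<tau> (Ds ! i)" if "i < length Ds" for i
    using that
  proof (induction i rule: less_induct)
    case (less i)
    then consider "Ds ! i \<in> \<psi>" | j k where "j < i" "k < i" "up_rule (Ds ! j) (Ds ! k) (Ds ! i)"
      using Ds(1) unfolding up_derivation_def by blast
    then show ?case
      by cases (use \<tau> less up_rule_sound in \<open>auto intro: up_rule_sound\<close>)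
  qed
  then show "satisfies \<tau> D"
    using Ds(2) by (metis in_set_conv_nth)
qed

section \<open>Variables fixed by propagation and residual clauses\<close>

definition up_assigned :: "'a xor_clause set \<Rightarrow> 'a set" where
  "up_assigned \<psi> = {x. up_derives \<psi> (pos x) \<or> up_derives \<psi> (neg x)}"

text \<open>The default is \<open>False\<close> if neither literal is derived; the value is
  \<open>True\<close> if both are.\<close>

definition up_value :: "'a xor_clause set \<Rightarrow> 'a \<Rightarrow> bool" where
  "up_value \<psi> x \<longleftrightarrow> up_derives \<psi> (pos x)"

text \<open>Substituting the derived values one variable at a time uses one UP rule each and
  preserves satisfaction under every assignment that agrees with these values.\<close>

lemma up_derives_residual:
  assumes "up_derives \<psi> C"
  obtains D where "up_derives \<psi> D" "fset (atoms D) = fset (atoms C) - up_assigned \<psi>"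
    and "\<And>\<tau>. (\<forall>x \<in> up_assigned \<psi>. \<tau> x = up_value \<psi> x) \<Longrightarrow> satisfies \<tau> D \<longleftrightarrow> satisfies \<tau> C"
proof -
  have "\<exists>D. up_derives \<psi> D \<and> fset (atoms D) = fset (atoms C) - A \<and>
      (\<forall>\<tau>. (\<forall>x \<in> up_assigned \<psi>. \<tau> x = up_value \<psi> x) \<longrightarrow> (satisfies \<tau> D \<longleftrightarrow> satisfies \<tau> C))"
    if "finite A" "A \<subseteq> up_assigned \<psi>" for A
    using that
  proof (induction A)
    case empty
    then show ?case
      using assms by auto
  next
    case (insert x A)
    then obtain D where D: "up_derives \<psi> D" "fset (atoms D) = fset (atoms C) - A"
      "\<And>\<tau>. (\<forall>x \<in> up_assigned \<psi>. \<tau> x = up_value \<psi> x) \<Longrightarrow> satisfies \<tau> D \<longleftrightarrow> satisfies \<tau> C"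
      by auto
    let ?D = "xor_subst D x (Xor {||} (up_value \<psi> x))"
    have x: "x \<in> up_assigned \<psi>"
      using insert.prems by blast
    have "up_derives \<psi> ?D"
    proof (cases "up_value \<psi> x")
      case True
      then show ?thesis
        using up_derives_step[OF _ D(1) up_pos] by (simp add: up_value_def xtrue_def)
    next
      case False
      then have "up_derives \<psi> (neg x)"
        using x by (simp add: up_value_def up_assigned_def)
      then show ?thesis
        using False up_derives_step[OF _ D(1) up_neg] by (simp add: xfalse_def)
    qed
    moreover have "fset (atoms ?D) = fset (atoms C) - insert x A"
      unfolding atoms_xor_subst using D(2) by auto
    moreover have "satisfies \<tau> ?D \<longleftrightarrow> satisfies \<tau> C"
      if "\<forall>x \<in> up_assigned \<psi>. \<tau> x = up_value \<psi> x" for \<tau>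
      using D(3)[OF that] satisfies_xor_subst that x by metis
    ultimately show ?case
      by blast
  qed
  \<comment> \<open>\<open>up_assigned \<psi>\<close> may be infinite, whereas only its finitely
    many members in \<open>C\<close> matter.\<close>
  from this[of "fset (atoms C) \<inter> up_assigned \<psi>"]
  obtain D where "up_derives \<psi> D"
    "fset (atoms D) = fset (atoms C) - fset (atoms C) \<inter> up_assigned \<psi>"
    "\<And>\<tau>. (\<forall>x \<in> up_assigned \<psi>. \<tau> x = up_value \<psi> x) \<Longrightarrow> satisfies \<tau> D \<longleftrightarrow> satisfies \<tau> C"
    by auto
  moreover have "A - A \<inter> B = A - B" for A B :: "'a set"
    by blast
  ultimately show thesis
    using that by simp
qed

text \<open>The value at \<open>x\<close> is free unless propagation fixes it. Clauses with an
  unassigned atom are handled by the forest argument, and the remaining ones reduce to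
  \<open>xtrue\<close>.\<close>

lemma tree_like_model_extending:
  assumes "finite \<phi>" "tree_like \<phi>" "L \<subseteq> lits \<phi>" "\<not> up_derives (\<phi> \<union> L) xfalse"
    and "\<And>y. y \<in> up_assigned (\<phi> \<union> L) \<Longrightarrow> \<tau>0 y = up_value (\<phi> \<union> L) y"
  shows "\<exists>\<tau>. \<tau> x = \<tau>0 x \<and> (\<forall>C \<in> \<phi> \<union> L. satisfies \<tau> C)"
proof -
  let ?\<psi> = "\<phi> \<union> L"
  let ?U = "up_assigned ?\<psi>"
  define F where "F = {C \<in> \<phi>. \<not> fset (atoms C) \<subseteq> ?U}"
  have "residual_edges F ?U \<subseteq> parcs (constraint_graph \<phi>)"
    by (auto simp: residual_edges_def constraint_graph_def F_def)
  then have free: "circuit_free (residual_edges F ?U)"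
    using assms(2) circuit_free_subset disjoint_union_of_trees_circuit_free
    unfolding tree_like_def by blast
  \<comment> \<open>With a single unassigned atom, the residual of \<open>C\<close> would be a
    derived literal, so that atom would be assigned after all.\<close>
  have two: "\<exists>y z. y \<noteq> z \<and> y |\<in>| atoms C \<and> z |\<in>| atoms C \<and> y \<notin> ?U \<and> z \<notin> ?U"
    if C: "C \<in> F" for C
  proof (rule ccontr)
    assume less: "\<not> ?thesis"
    obtain y where y: "y |\<in>| atoms C" "y \<notin> ?U"
      using C by (auto simp: F_def)
    have "C \<in> ?\<psi>"
      using C by (simp add: F_def)
    then obtain D where D: "up_derives ?\<psi> D" "fset (atoms D) = fset (atoms C) - ?U"
      using up_derives_residual[OF up_derives_base] by blast
    have "fset (atoms D) = fset {|y|}"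
      unfolding D(2) using less y by auto
    then have "atoms D = {|y|}"
      by (simp only: fset_inject)
    then have "D = pos y \<or> D = neg y"
      by (cases D) (auto simp: pos_def neg_def)
    then show False
      using D(1) y(2) by (auto simp: up_assigned_def)
  qed
  obtain \<tau> where \<tau>: "\<And>y. y \<in> insert x ?U \<Longrightarrow> \<tau> y = \<tau>0 y" "\<And>C. C \<in> F \<Longrightarrow> satisfies \<tau> C"
    using forest_model_extending[OF _ free two, of x \<tau>0] assms(1) by (auto simp: F_def)
  have "satisfies \<tau> C" if C: "C \<in> ?\<psi>" for C
  proof (cases "C \<in> F")
    case False
    have "fset (atoms C) \<subseteq> ?U"
    proof (cases "C \<in> \<phi>")
      case True
      then show ?thesis
        using False by (simp add: F_def)
    next
      case notin: False
      then obtain y where "C = pos y \<or> C = neg y"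
        using C assms(3) by (auto simp: lits_def)
      then show ?thesis
        using up_derives_base[OF C] by (auto simp: up_assigned_def pos_def neg_def)
    qed
    moreover obtain D where D: "up_derives ?\<psi> D" "fset (atoms D) = fset (atoms C) - ?U"
      and eqv: "\<And>\<tau>. (\<forall>x \<in> ?U. \<tau> x = up_value ?\<psi> x) \<Longrightarrow> satisfies \<tau> D \<longleftrightarrow> satisfies \<tau> C"
      using up_derives_residual[OF up_derives_base[OF C]] by blast
    \<comment> \<open>A residual without atoms is a constant, and \<open>xfalse\<close> is excluded
      by assumption.\<close>
    ultimately have "atoms D = {||}"
      by (metis Diff_eq_empty_iff bot_fset.rep_eq fset_inject)
    moreover have "D \<noteq> xfalse"
      using D(1) assms(4) by blast
    ultimately have "D = xtrue"
      by (cases D) (auto simp: xtrue_def xfalse_def)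
    then have "satisfies \<tau> D"
      by (simp add: xtrue_def)
    then show ?thesis
      using eqv \<tau>(1) assms(5) by simp
  qed (use \<tau>(2) in blast)
  then show ?thesis
    using \<tau>(1) by blast
qed

theorem theorem1:
  fixes \<phi> :: "'a xor_clause set"
  assumes "finite \<phi>"
    and "tree_like \<phi>"
  shows "up_deducible \<phi>"
  unfolding up_deducible_def
proof (intro allI impI conjI ballI)
  fix ls :: "'a xor_clause list"
  assume ls: "set ls \<subseteq> lits \<phi>"
  let ?\<psi> = "\<phi> \<union> set ls"
  note model = tree_like_model_extending[OF assms ls]
  show "up_derives ?\<psi> xfalse" if "\<not> satisfiable ?\<psi>"
    using that model[of "up_value ?\<psi>"] unfolding satisfiable_def by blast
  fix m
  assume m: "m \<in> lits \<phi>" and sat: "satisfiable ?\<psi>" and ent: "entails ?\<psi> m"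
  have consistent: "\<not> up_derives ?\<psi> xfalse"
    using up_derives_sound[of ?\<psi> xfalse] sat
    by (auto simp: entails_def satisfiable_def xfalse_def)
  obtain x where x: "m = pos x \<or> m = neg x"
    using m by (auto simp: lits_def)
  show "up_derives ?\<psi> m"
  proof (cases "x \<in> up_assigned ?\<psi>")
    case True
    \<comment> \<open>By soundness, the literal of \<open>x\<close> that was derived holds in this
      model, as does \<open>m\<close>; hence they coincide.\<close>
    obtain \<tau> where "\<forall>C \<in> ?\<psi>. satisfies \<tau> C"
      using sat unfolding satisfiable_def by blast
    then have "satisfies \<tau> m" "up_derives ?\<psi> (pos x) \<Longrightarrow> \<tau> x" "up_derives ?\<psi> (neg x) \<Longrightarrow> \<not> \<tau> x"
      using ent up_derives_sound unfolding entails_def by fastforce+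
    then show ?thesis
      using True x by (auto simp: up_assigned_def)
  next
    case False
    then have "((up_value ?\<psi>)(x := b)) y = up_value ?\<psi> y" if "y \<in> up_assigned ?\<psi>" for b y
      using that by auto
    then have "\<exists>\<tau>. \<tau> x = b \<and> (\<forall>C \<in> ?\<psi>. satisfies \<tau> C)" for b
      using model[OF consistent, of "(up_value ?\<psi>)(x := b)" x] by auto
    \<comment> \<open>The value of \<open>x\<close> is chosen to falsify \<open>m\<close>, so this
      model contradicts the entailment.\<close>
    then obtain \<tau> where "\<tau> x \<longleftrightarrow> m = neg x" "\<forall>C \<in> ?\<psi>. satisfies \<tau> C"
      by blast
    moreover from this(2) have "satisfies \<tau> m"
      using ent by (simp add: entails_def)
    moreover have "pos x \<noteq> neg x"
      by (simp add: pos_def neg_def)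
    ultimately show ?thesis
      using x by auto
  qed
qed

end
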